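(* Let $V=\{1,\ldots,n\}$, let $k$ be a positive integer, and let $f:2^V\to\mathbb{R}_+$ be a non-negative, normalized ($f(\emptyset)=0$), monotone submodular function which is $(c,\theta)$-monotonic sharp for some $c\ge 1$ and $\theta\in[0,1]$. Then the greedy algorithm returns a feasible set $S^g$ for the problem $\max\{f(S): |S|\le k\}$ such that \[ f(S^g)\ \ge\ \left[1-\left(1-\frac{\theta}{c}\right)^{\frac{1}{\theta}}\right]\cdot f(S^* ), \] where $S^*$ is an optimal solution of that problem.
   Context: For $A\subseteq V$ and $e\in V$, the marginal value is $f_A(e):=f(A\cup\{e\})-f(A)$. $f$ is submodular if $f_A(e)\ge f_B(e)$ for all $A\subseteq B\subseteq V\setminus\{e\}$, and monotone if $f(A)\le f(B)$ whenever $A\subseteq B$. The problem (P$_1$) is $\max\{f(S):S\subseteq V,\ |S|\le k\}$ with optimal value $\mathrm{OPT}$. Given $c\ge1$ and $\theta\in[0,1]$, $f$ is $(c,\theta)$-monotonic sharp if there exists an optimal solution $S^*$ of (P$_1$) such that for every $S\subseteq V$ with $|S|\le k$, \[ \sum_{e\in S^*\setminus S} f_S(e)\ \ge\ \left(\frac{|S^*\setminus S|}{k\cdot c}\right)^{1/\theta}\cdot \mathrm{OPT}. \] The greedy algorithm starts with $S=\emptyset$ and, while $|S|<k$, adds to $S$ an element of $\arg\max_{e\in V\setminus S} f_S(e)$; its output is $S^g$. *)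

theory Defs
  imports "HOL-Real_Asymp.Real_Asymp"
begin

definition marginal :: "('a set \<Rightarrow> real) \<Rightarrow> 'a set \<Rightarrow> 'a \<Rightarrow> real" where
  "marginal f A e = f (A \<union> {e}) - f A"

definition submodular_on :: "'a set \<Rightarrow> ('a set \<Rightarrow> real) \<Rightarrow> bool" where
  "submodular_on V f \<longleftrightarrow>
     (\<forall>A B e. e \<in> V \<longrightarrow> A \<subseteq> B \<longrightarrow> B \<subseteq> V - {e} \<longrightarrow> marginal f A e \<ge> marginal f B e)"

definition feasible :: "'a set \<Rightarrow> nat \<Rightarrow> 'a set \<Rightarrow> bool" where
  "feasible V k S \<longleftrightarrow> S \<subseteq> V \<and> card S \<le> k"

definition optimal_solution :: "'a set \<Rightarrow> ('a set \<Rightarrow> real) \<Rightarrow> nat \<Rightarrow> 'a set \<Rightarrow> bool" where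
  "optimal_solution V f k S \<longleftrightarrow> is_arg_max f (feasible V k) S"

definition OPT :: "'a set \<Rightarrow> ('a set \<Rightarrow> real) \<Rightarrow> nat \<Rightarrow> real" where
  "OPT V f k = Max {f S |S. feasible V k S}"

text \<open>
  The exponent \<open>1 / \<theta>\<close> has no meaning at \<open>\<theta> = 0\<close>. There, both expressions in which it
  occurs are given the value of their limit for \<open>\<theta>\<close> tending to 0 from the right;
  see \<open>root_power_tendsto_0\<close> (only bases \<open>x\<close> in the unit interval occur) and
  \<open>greedy_ratio_tendsto_0\<close>.
\<close>

definition root_power :: "real \<Rightarrow> real \<Rightarrow> real" where
  "root_power x \<theta> = (if \<theta> = 0 then (if x = 1 then 1 else 0) else x powr (1 / \<theta>))"

definition greedy_ratio :: "real \<Rightarrow> real \<Rightarrow> real" where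
  "greedy_ratio c \<theta> =
     (if \<theta> = 0 then 1 - exp (- 1 / c) else 1 - (1 - \<theta> / c) powr (1 / \<theta>))"

lemma root_power_tendsto_0:
  assumes "0 \<le> x" "x \<le> 1"
  shows "((\<lambda>\<theta>. x powr (1 / \<theta>)) \<longlongrightarrow> root_power x 0) (at_right 0)"
proof -
  consider "x = 0" | "x = 1" | "0 < x" "x < 1" using assms by fastforce
  then show ?thesis
  proof cases
    case 3
    then show ?thesis unfolding root_power_def by (simp, real_asymp)
  qed (simp_all add: root_power_def)
qed

lemma greedy_ratio_tendsto_0:
  assumes "c \<ge> 1"
  shows "((\<lambda>\<theta>. 1 - (1 - \<theta> / c) powr (1 / \<theta>)) \<longlongrightarrow> greedy_ratio c 0) (at_right 0)"
proof -
  have "c > 0" using assms by simp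
  then show ?thesis unfolding greedy_ratio_def by (simp, real_asymp simp: field_simps)
qed

definition monotonic_sharp ::
    "'a set \<Rightarrow> ('a set \<Rightarrow> real) \<Rightarrow> nat \<Rightarrow> real \<Rightarrow> real \<Rightarrow> bool" where
  "monotonic_sharp V f k c \<theta> \<longleftrightarrow>
     (\<exists>Sopt. optimal_solution V f k Sopt \<and>
        (\<forall>S. S \<subseteq> V \<longrightarrow> card S \<le> k \<longrightarrow>
           (\<Sum>e\<in>Sopt - S. marginal f S e)
             \<ge> root_power (real (card (Sopt - S)) / (real k * c)) \<theta> * OPT V f k))"

text \<open>
  The sets reachable by the greedy algorithm, under every possible way of breaking ties.
\<close>

inductive greedy_reachable :: "'a set \<Rightarrow> ('a set \<Rightarrow> real) \<Rightarrow> nat \<Rightarrow> 'a set \<Rightarrow> bool"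
  for V :: "'a set" and f :: "'a set \<Rightarrow> real" and k :: nat where
  start: "greedy_reachable V f k {}"
| step: "greedy_reachable V f k S \<Longrightarrow> card S < k \<Longrightarrow>
         is_arg_max (marginal f S) (\<lambda>e. e \<in> V - S) e \<Longrightarrow>
         greedy_reachable V f k (S \<union> {e})"

text \<open>
  If \<open>k\<close> exceeds the size of \<open>V\<close>, the algorithm stops with output \<open>V\<close>, as there is no
  element left to add.
\<close>

definition greedy_output :: "'a set \<Rightarrow> ('a set \<Rightarrow> real) \<Rightarrow> nat \<Rightarrow> 'a set \<Rightarrow> bool" where
  "greedy_output V f k S \<longleftrightarrow> greedy_reachable V f k S \<and> (\<not> card S < k \<or> V - S = {})"

end

(* Normalize the gap to the optimum of a greedy set S as a = 1 - f S / OPT.  Let W be the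
   sum of the marginals over the m elements of the sharp optimal solution outside S.
   Submodularity gives W / OPT >= a, and the greedy gain is at least W / m.  Sharpness bounds
   m <= k c (W / OPT)^theta, so one step lowers the gap by at least a^(1 - theta) / (k c).
   By weighted AM-GM, a^theta then drops by at least theta / (k c) per step; this is Euler's
   method for y' = -y^(1 - theta) / c, along which y^theta decreases linearly.  For theta = 0
   the gap contracts by the factor 1 - 1 / (k c). *)

theory Submission
  imports Defs "HOL-Analysis.Convex"
begin

section \<open>Marginal sums under submodularity and greedy choice\<close>

text \<open>Adding the elements of \<open>T\<close> one at a time telescopes the left side;
  diminishing returns replaces each marginal over a larger set by the one over
  \<open>S\<close>.\<close>

lemma submodular_sum_marginal:
  assumes "submodular_on V f" "S \<subseteq> V" "T \<subseteq> V" "finite T"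
  shows "f (S \<union> T) - f S \<le> (\<Sum>e\<in>T - S. marginal f S e)"
  using assms(4,3)
proof (induction T rule: finite_induct)
  case (insert x T)
  have IH: "f (S \<union> T) - f S \<le> (\<Sum>e\<in>T - S. marginal f S e)"
    using insert by simp
  show ?case
  proof (cases "x \<in> S")
    case True
    then show ?thesis using IH by (simp add: insert_absorb insert_Diff_if)
  next
    case False
    have "S \<union> T \<subseteq> V - {x}" "x \<in> V"
      using insert.prems insert.hyps False assms(2) by auto
    then have "marginal f (S \<union> T) x \<le> marginal f S x"
      using assms(1) unfolding submodular_on_def by blast
    then have "f (S \<union> insert x T) \<le> f (S \<union> T) + marginal f S x"
      unfolding marginal_def by simp
    then show ?thesis
      using IH False insert.hyps by (simp add: insert_Diff_if)
  qed
qed simp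

lemma greedy_gain:
  fixes f :: "'a set \<Rightarrow> real"
  assumes "is_arg_max (marginal f S) (\<lambda>e. e \<in> V - S) e" "T \<subseteq> V"
  shows "(\<Sum>x\<in>T - S. marginal f S x) \<le> real (card (T - S)) * marginal f S e"
proof (rule sum_bounded_above)
  fix x assume "x \<in> T - S"
  then show "marginal f S x \<le> marginal f S e"
    using assms unfolding is_arg_max_linorder by blast
qed

section \<open>Effect of one greedy step on the gap\<close>

text \<open>Averaging gives \<open>g \<ge> w / m\<close> and sharpness gives
  \<open>m \<le> K * w powr \<theta>\<close>, so \<open>g\<close> is at least
  \<open>w powr (1 - \<theta>) / K\<close>. The exponent is nonnegative, so \<open>w\<close> may be
  lowered to \<open>a\<close>.\<close>

lemma sharp_gap_reduction:
  fixes a w m K g \<theta> :: real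
  assumes "0 < a" "a \<le> w" "0 < m" "m \<le> K" "w \<le> m * g" "0 \<le> \<theta>" "\<theta> \<le> 1"
    and sharp: "root_power (m / K) \<theta> \<le> w"
  shows "a powr (1 - \<theta>) / K \<le> g"
proof -
  have "m \<le> K * w powr \<theta>"
  proof (cases "\<theta> = 0")
    \<comment> \<open>Since \<open>w > 0\<close>, the factor \<open>w powr 0\<close> is 1 and the
      claim is \<open>m \<le> K\<close>.\<close>
    case True
    then show ?thesis using assms by simp
  next
    case False
    then have "((m / K) powr (1 / \<theta>)) powr \<theta> \<le> w powr \<theta>"
      using assms by (intro powr_mono2) (auto simp: root_power_def)
    then show ?thesis using False assms by (simp add: powr_powr field_simps)
  qed
  \<comment> \<open>On the right the powers of \<open>w\<close> recombine to \<open>w\<close>, which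
    is at most \<open>m * g\<close>; then the common factor \<open>m > 0\<close> cancels.\<close>
  then have "m * w powr (1 - \<theta>) \<le> K * w powr \<theta> * w powr (1 - \<theta>)"
    by (intro mult_right_mono) auto
  also have "\<dots> = K * w"
    using assms by (simp add: mult.assoc flip: powr_add)
  also have "\<dots> \<le> m * (K * g)"
    using assms by (simp add: mult.left_commute mult_left_mono)
  finally have "w powr (1 - \<theta>) \<le> K * g"
    using assms by simp
  moreover have "a powr (1 - \<theta>) \<le> w powr (1 - \<theta>)"
    using assms by (intro powr_mono2) auto
  ultimately show ?thesis
    using assms by (simp add: field_simps)
qed

text \<open>The gap drops by exactly the greedy marginal divided by \<open>f T\<close>. The scalar
  estimate bounds this drop, with the marginal sum over \<open>T - S\<close>, also divided by
  \<open>f T\<close>, as \<open>w\<close>.\<close>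

lemma greedy_gap_step:
  fixes f :: "'a set \<Rightarrow> real" and K \<theta> :: real
  defines "gap \<equiv> \<lambda>S T. 1 - f S / f T"
  assumes "finite V" "mono_on (Pow V) f" "submodular_on V f" "S \<subseteq> V" "T \<subseteq> V"
    and "real (card T) \<le> K" "0 \<le> \<theta>" "\<theta> \<le> 1"
    and "0 < f T" "f S < f T"
    and greedy: "is_arg_max (marginal f S) (\<lambda>e. e \<in> V - S) e"
    and sharp: "root_power (real (card (T - S)) / K) \<theta> * f T
                  \<le> (\<Sum>x\<in>T - S. marginal f S x)"
  shows "gap (S \<union> {e}) T \<le> gap S T - gap S T powr (1 - \<theta>) / K"
proof -
  define W where "W = (\<Sum>x\<in>T - S. marginal f S x)"
  have fin: "finite T" using assms finite_subset by blast
  have "f T \<le> f (S \<union> T)"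
    using assms by (intro mono_onD[of "Pow V" f]) auto
  then have W: "f T - f S \<le> W"
    using submodular_sum_marginal[of V f S T] assms fin unfolding W_def by auto
  \<comment> \<open>Averaging over \<open>T - S\<close> needs \<open>m > 0\<close>; an empty sum
    could not dominate the positive difference \<open>f T - f S\<close>.\<close>
  have "T - S \<noteq> {}"
  proof
    assume "T - S = {}"
    then have "W = 0" by (simp only: W_def sum.empty)
    then show False using W \<open>f S < f T\<close> by simp
  qed
  then have m: "0 < card (T - S)" using fin by (simp add: card_gt_0_iff)
  have mK: "real (card (T - S)) \<le> K"
    using assms fin card_mono[of T "T - S"] by auto
  have "gap S T powr (1 - \<theta>) / K \<le> marginal f S e / f T"
  proof (rule sharp_gap_reduction[where w = "W / f T" and m = "real (card (T - S))"])
    show "gap S T \<le> W / f T"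
      using divide_right_mono[OF W, of "f T"] \<open>0 < f T\<close> by (simp add: gap_def diff_divide_distrib)
    show "W / f T \<le> real (card (T - S)) * (marginal f S e / f T)"
      using greedy_gain[OF greedy \<open>T \<subseteq> V\<close>] assms by (simp add: W_def divide_right_mono)
    show "root_power (real (card (T - S)) / K) \<theta> \<le> W / f T"
      using sharp assms by (simp add: W_def field_simps)
  qed (use assms m mK in \<open>auto simp: gap_def\<close>)
  then show ?thesis
    by (simp add: gap_def marginal_def diff_divide_distrib)
qed

text \<open>The concave power function lies below its tangent at \<open>a\<close>. Young's
  inequality is this tangent bound multiplied by \<open>a powr (1 - \<theta>)\<close>.\<close>

lemma powr_decrease_step:
  fixes a b d \<theta> :: real
  assumes "0 < a" "0 \<le> b" "b \<le> a - a powr (1 - \<theta>) * d" "0 \<le> \<theta>" "\<theta> \<le> 1"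
  shows "b powr \<theta> \<le> a powr \<theta> - \<theta> * d"
proof -
  have split: "a powr \<theta> * a powr (1 - \<theta>) = a"
    using assms by (simp flip: powr_add)
  \<comment> \<open>For \<open>b = 0\<close> the left side vanishes, as
    \<open>0 powr \<theta>\<close> is 0 even at \<open>\<theta> = 0\<close>.\<close>
  have "b powr \<theta> * a powr (1 - \<theta>) \<le> \<theta> * b + (1 - \<theta>) * a"
    using Youngs_inequality_0[of \<theta> "1 - \<theta>" b a] assms by (cases "b = 0") auto
  also have "\<dots> \<le> \<theta> * (a - a powr (1 - \<theta>) * d) + (1 - \<theta>) * a"
    using assms by (simp add: mult_left_mono)
  also have "\<dots> = (a powr \<theta> - \<theta> * d) * a powr (1 - \<theta>)"
    using split by (simp add: algebra_simps)
  finally show ?thesis using assms by simp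
qed

section \<open>Feasibility and existence of greedy outputs\<close>

lemma greedy_reachable_feasible:
  assumes "greedy_reachable V f k S" "finite V"
  shows "S \<subseteq> V \<and> card S \<le> k"
  using assms
proof induction
  case (step S e)
  then have "e \<in> V - S" by (simp add: is_arg_max_def)
  then show ?case using step finite_subset[of S V] by auto
qed simp

text \<open>A reachable set of maximal cardinality is an output: otherwise the finite nonempty
  \<open>V - S\<close> has a best element, and adding it gives a larger reachable set.\<close>

lemma ex_greedy_output:
  fixes f :: "'a set \<Rightarrow> real"
  assumes "finite V"
  shows "\<exists>S. greedy_output V f k S"
proof -
  let ?P = "greedy_reachable V f k"
  have "\<forall>S. ?P S \<longrightarrow> card S < Suc k"
    using greedy_reachable_feasible[OF _ assms] by (simp add: less_Suc_eq_le)
  then obtain S where S: "?P S" "\<And>S'. ?P S' \<Longrightarrow> card S' \<le> card S"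
    using ex_has_greatest_nat[of ?P "{}" card "Suc k"] greedy_reachable.start by blast
  have "\<not> card S < k \<or> V - S = {}"
  proof (rule ccontr)
    assume "\<not> ?thesis"
    then have less: "card S < k" and "V - S \<noteq> {}" by auto
    then have "Max (marginal f S ` (V - S)) \<in> marginal f S ` (V - S)"
      using assms by (intro Max_in) auto
    then obtain e where "e \<in> V - S" "marginal f S e = Max (marginal f S ` (V - S))"
      by auto
    then have e: "is_arg_max (marginal f S) (\<lambda>e. e \<in> V - S) e"
      using assms unfolding is_arg_max_linorder by simp
    have "?P (S \<union> {e})" using greedy_reachable.step[OF S(1) less e] .
    moreover have "card (S \<union> {e}) = Suc (card S)"
      using e assms greedy_reachable_feasible[OF S(1) assms] finite_subset[of S V]
      by (simp add: is_arg_max_def)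
    ultimately show False using S(2) by fastforce
  qed
  then show ?thesis using S(1) unfolding greedy_output_def by blast
qed

lemma optimal_solution_eq_OPT:
  assumes "finite V" "optimal_solution V f k T"
  shows "f T = OPT V f k"
proof -
  have "finite {f S |S. feasible V k S}"
    using assms(1) by (rule finite_surj[OF finite_Pow_iff[THEN iffD2]])
      (auto simp: feasible_def)
  then show ?thesis
    using assms(2) unfolding OPT_def optimal_solution_def is_arg_max_linorder
    by (intro Max_eqI[symmetric]) auto
qed

section \<open>The gap along a greedy run and the approximation ratio\<close>

text \<open>Induction along the run, starting from gap 1. At \<open>\<theta> = 0\<close> the second
  conjunct only says that a power is at most 1, so geometric decay is tracked separately.\<close>

lemma greedy_gap_bound:
  fixes f :: "'a set \<Rightarrow> real" and c \<theta> :: real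
  defines "gap \<equiv> \<lambda>S T. 1 - f S / f T"
  assumes "finite V" "mono_on (Pow V) f" "submodular_on V f" "f {} = 0"
    and "k > 0" "c \<ge> 1" "0 \<le> \<theta>" "\<theta> \<le> 1"
    and T: "T \<subseteq> V" "card T \<le> k" "0 < f T"
    and opt: "\<And>S. S \<subseteq> V \<Longrightarrow> card S \<le> k \<Longrightarrow> f S \<le> f T"
    and sharp: "\<And>S. S \<subseteq> V \<Longrightarrow> card S \<le> k \<Longrightarrow>
      root_power (real (card (T - S)) / (real k * c)) \<theta> * f T \<le> (\<Sum>e\<in>T - S. marginal f S e)"
    and "greedy_reachable V f k S"
  shows "(\<theta> = 0 \<longrightarrow> gap S T \<le> (1 - 1 / (real k * c)) ^ card S) \<and>
         gap S T powr \<theta> \<le> 1 - \<theta> * (card S / (real k * c))"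
  using assms(15)
proof induction
  case start
  then show ?case using assms by simp
next
  case (step S e)
  define K where "K = real k * c"
  define a where "a = gap S T"
  define b where "b = gap (S \<union> {e}) T"
  have kK: "real k \<le> K" using assms by (simp add: K_def)
  have K1: "1 \<le> K" using kK \<open>k > 0\<close> by simp
  have S: "S \<subseteq> V" "card S \<le> k"
    using greedy_reachable_feasible[OF step.hyps(1) assms(2)] by auto
  have Se: "S \<union> {e} \<subseteq> V" "card (S \<union> {e}) \<le> k"
    using greedy_reachable_feasible[OF greedy_reachable.step[OF step.hyps] assms(2)] by auto
  have card: "card (S \<union> {e}) = Suc (card S)"
    using step.hyps S assms(2) finite_subset[of S V] by (simp add: is_arg_max_def)
  have "f S \<le> f (S \<union> {e})"
    using assms(3) S Se by (intro mono_onD[of "Pow V" f]) auto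
  then have ab: "0 \<le> b" "b \<le> a"
    using opt[OF Se] T by (auto simp: a_def b_def gap_def divide_right_mono)
  have IH: "\<theta> = 0 \<longrightarrow> a \<le> (1 - 1 / K) ^ card S" "a powr \<theta> \<le> 1 - \<theta> * (card S / K)"
    using step.IH by (auto simp: a_def K_def)
  have le1: "real (Suc (card S)) / K \<le> 1"
    using Se kK K1 unfolding card by (simp add: field_simps)
  \<comment> \<open>This settles the case where the gap is already 0 and stays 0: the left side is
    then \<open>0 powr \<theta> = 0\<close>, and the linear bound is nonnegative because at most
    \<open>k \<le> K\<close> elements are chosen.\<close>
  have room: "0 \<le> 1 - \<theta> * (real (Suc (card S)) / K)"
    using mult_mono[of \<theta> 1 "real (Suc (card S)) / K" 1] le1 K1 assms by simp
  show ?case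
  proof (cases "a = 0")
    case True
    then have "b = 0" using ab by simp
    then show ?thesis using room K1 card by (auto simp: b_def K_def)
  next
    case False
    then have "0 < a" using ab by simp
    then have "f S < f T" using T by (simp add: a_def gap_def field_simps)
    then have "b \<le> a - a powr (1 - \<theta>) / K"
      unfolding a_def b_def gap_def
      using assms S T kK step.hyps
      by (intro greedy_gap_step) (auto simp: K_def intro: order_trans[OF of_nat_mono])
    then have dec: "b \<le> a - a powr (1 - \<theta>) * (1 / K)" by simp
    have "b \<le> (1 - 1 / K) ^ card (S \<union> {e})" if "\<theta> = 0"
    proof -
      have "b \<le> (1 - 1 / K) * a" using dec that \<open>0 < a\<close> by (simp add: algebra_simps)
      also have "\<dots> \<le> (1 - 1 / K) * (1 - 1 / K) ^ card S"
        using IH(1) that K1 by (intro mult_left_mono) auto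
      finally show ?thesis using card by simp
    qed
    moreover have "b powr \<theta> \<le> 1 - \<theta> * (card (S \<union> {e}) / K)"
    proof -
      have "b powr \<theta> \<le> a powr \<theta> - \<theta> * (1 / K)"
        using powr_decrease_step[OF \<open>0 < a\<close> ab(1) dec] assms by blast
      then show ?thesis using IH(2) card by (simp add: algebra_simps add_divide_distrib)
    qed
    ultimately show ?thesis by (simp add: b_def K_def)
  qed
qed

theorem theorem1:
  fixes n k :: nat and V :: "nat set" and f :: "nat set \<Rightarrow> real" and c \<theta> :: real
  assumes "V = {1..n}"
    and "k > 0"
    and "\<And>S. S \<subseteq> V \<Longrightarrow> f S \<ge> 0"
    and "f {} = 0"
    and "mono_on (Pow V) f"
    and "submodular_on V f"
    and "c \<ge> 1" and "0 \<le> \<theta>" and "\<theta> \<le> 1"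
    and "monotonic_sharp V f k c \<theta>"
  shows "(\<exists>Sg. greedy_output V f k Sg) \<and>
         (\<forall>Sg. greedy_output V f k Sg \<longrightarrow>
            feasible V k Sg \<and>
            (\<forall>Sopt. optimal_solution V f k Sopt \<longrightarrow> f Sg \<ge> greedy_ratio c \<theta> * f Sopt))"
proof (intro conjI allI impI)
  have fin: "finite V" using assms(1) by simp
  show "\<exists>Sg. greedy_output V f k Sg" using ex_greedy_output[OF fin] .
  fix Sg assume "greedy_output V f k Sg"
  then have Sg: "greedy_reachable V f k Sg" "\<not> card Sg < k \<or> V - Sg = {}"
    unfolding greedy_output_def by auto
  have SgV: "Sg \<subseteq> V" "card Sg \<le> k"
    using greedy_reachable_feasible[OF Sg(1) fin] by auto
  then show "feasible V k Sg" by (simp add: feasible_def)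
  fix Sopt assume "optimal_solution V f k Sopt"
  then have Sopt: "f Sopt = OPT V f k" using optimal_solution_eq_OPT[OF fin] by blast
  \<comment> \<open>The sharp solution \<open>T\<close> need not be the given \<open>Sopt\<close>,
    but both have value \<open>OPT V f k\<close>.\<close>
  obtain T where "optimal_solution V f k T"
    and sharp: "\<And>S. S \<subseteq> V \<Longrightarrow> card S \<le> k \<Longrightarrow>
      root_power (real (card (T - S)) / (real k * c)) \<theta> * OPT V f k \<le> (\<Sum>e\<in>T - S. marginal f S e)"
    using assms(10) unfolding monotonic_sharp_def by blast
  then have T: "T \<subseteq> V" "card T \<le> k" "f T = OPT V f k"
    and opt: "\<And>S. S \<subseteq> V \<Longrightarrow> card S \<le> k \<Longrightarrow> f S \<le> f T"
    using optimal_solution_eq_OPT[OF fin]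
    unfolding optimal_solution_def is_arg_max_linorder feasible_def by auto
  have "greedy_ratio c \<theta> * f T \<le> f Sg"
  \<comment> \<open>The gap argument divides by \<open>f T\<close> and needs a run of exactly
    \<open>k\<close> elements. If \<open>V\<close> is exhausted earlier, the output contains
    \<open>T\<close> and monotonicity suffices.\<close>
  proof (cases "V \<subseteq> Sg \<or> f T = 0")
    case True
    have "f T \<le> f Sg"
    proof (cases "f T = 0")
      case True
      then show ?thesis using assms(3)[OF SgV(1)] by simp
    next
      case False
      then have "T \<subseteq> Sg" using \<open>V \<subseteq> Sg \<or> f T = 0\<close> T by auto
      then show ?thesis using T SgV by (intro mono_onD[OF assms(5)]) auto
    qed
    moreover have "greedy_ratio c \<theta> * f T \<le> 1 * f T"
      using assms(3)[OF T(1)] by (intro mult_right_mono) (auto simp: greedy_ratio_def)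
    ultimately show ?thesis by simp
  next
    case False
    define a where "a = 1 - f Sg / f T"
    have pos: "0 < f T" using assms(3)[OF T(1)] False by simp
    have k: "card Sg = k" using Sg(2) SgV False by auto
    have bound: "\<theta> = 0 \<longrightarrow> a \<le> (1 - 1 / (real k * c)) ^ k"
        "a powr \<theta> \<le> 1 - \<theta> * (k / (real k * c))"
      using greedy_gap_bound[of V f k c \<theta> T Sg] fin assms(2,4-9) T pos opt sharp Sg(1)
      unfolding a_def k by auto
    have a0: "0 \<le> a" using opt[OF SgV] pos by (simp add: a_def)
    have "a \<le> 1 - greedy_ratio c \<theta>"
    proof (cases "\<theta> = 0")
      case True
      \<comment> \<open>With \<open>x = 1 / c\<close> this is the standard bound of the
        \<open>k\<close>-th power of \<open>1 - x / k\<close> by \<open>exp (- x)\<close>.\<close>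
      have "(1 - 1 / (real k * c)) ^ k = (1 - (1 / c) / real k) ^ k"
        by (simp add: mult.commute)
      also have "\<dots> \<le> exp (- (1 / c))"
      proof (rule exp_ge_one_minus_x_over_n_power_n)
        have "1 / c \<le> 1" using assms(7) by simp
        also have "1 \<le> real k" using assms(2) by simp
        finally show "1 / c \<le> real k" .
      qed (use assms(2) in simp)
      finally show ?thesis using bound(1) True by (simp add: greedy_ratio_def)
    next
      case False
      \<comment> \<open>After \<open>k\<close> steps the factor \<open>k\<close> cancels and the
        linear bound is \<open>1 - \<theta> / c\<close>; taking the power
        \<open>1 / \<theta>\<close> recovers \<open>a\<close>, which is nonnegative.\<close>
      have "a = (a powr \<theta>) powr (1 / \<theta>)" using False a0 by (simp add: powr_powr)
      also have "\<dots> \<le> (1 - \<theta> / c) powr (1 / \<theta>)"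
        using bound(2) assms by (intro powr_mono2) auto
      finally show ?thesis using False by (simp add: greedy_ratio_def)
    qed
    then show ?thesis using pos by (simp add: a_def field_simps)
  qed
  then show "greedy_ratio c \<theta> * f Sopt \<le> f Sg" using T(3) Sopt by simp
qed

end
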